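(* Let $\Omega\subset\mathbb{R}^N$ ($N\ge 2$) be a bounded smooth domain, $0<s<1<p<\infty$, and let $\omega\in L^r(\Omega)\setminus\{0\}$ with $r>1$ and $\omega\ge0$. Let $$\mu:=\lim_{\alpha\to1^-}\lambda_\alpha\|\omega\|_1^{\frac{p}{1-\alpha}}\in(0,\infty],\qquad \lambda_\alpha:=\min\Big\{[v]_{s,p}^p:\ v\in W_0^{s,p}(\Omega),\ \int_\Omega|v|^{1-\alpha}\omega\,dx=1\Big\},$$ and suppose that $\mu<\infty$. Then $$\mu\exp\left(\frac{p}{\|\omega\|_1}\int_\Omega(\log|v|)\,\omega\,dx\right)\le[v]_{s,p}^p\quad\text{for all }v\in W_0^{s,p}(\Omega).$$
   Context: Gagliardo semi-norm: $[u]_{s,p}:=\left(\iint_{\mathbb{R}^{2N}}\frac{|u(x)-u(y)|^p}{|x-y|^{N+sp}}\,dx\,dy\right)^{1/p}$. $W_0^{s,p}(\Omega)$ is the completion of $C_c^\infty(\Omega)$ with respect to $([u]_{s,p}^p+\|u\|_p^p)^{1/p}$; equivalently $W_0^{s,p}(\Omega)=\{u\in L^p(\mathbb{R}^N):[u]_{s,p}<\infty,\ u=0 \text{ in }\mathbb{R}^N\setminus\Omega\}$, normed by $[\cdot]_{s,p}$. $\|\cdot\|_1$ is the $L^1(\Omega)$ norm. Exponents: $p_s^\star:=\frac{Np}{N-sp}$ if $N>sp$ and $p_s^\star:=\infty$ if $N\le sp$; $t':=t/(t-1)$. For $0<\alpha<1$: $r_\alpha:=\left(\frac{p_s^\star}{1-\alpha}\right)'$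 if $sp<N$, and $r_\alpha:=\alpha^{-1}$ if $sp\ge N$. The minimum $\lambda_\alpha$ exists whenever $r\ge r_\alpha$; since $r>1$ and $r_\alpha\to1^+$ as $\alpha\to1^-$, there is $\alpha_0\in(0,1)$ with $r\ge r_\alpha$ for all $\alpha\in[\alpha_0,1)$. On $[\alpha_0,1)$ the map $\alpha\mapsto\lambda_\alpha\|\omega\|_1^{p/(1-\alpha)}$ is nondecreasing, so the limit $\mu$ exists in $(0,\infty]$. The integral $\int_\Omega(\log|v|)\omega\,dx$ takes values in $[-\infty,\infty)$ and $\exp(-\infty)=0$. *)

theory Defs
  imports "HOL-Analysis.Analysis"
begin

primrec C_k :: "nat \<Rightarrow> ('a::euclidean_space \<Rightarrow> real) \<Rightarrow> bool" where
  "C_k 0 f \<longleftrightarrow> continuous_on UNIV f"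
| "C_k (Suc k) f \<longleftrightarrow>
     (\<exists>f'. (\<forall>x. (f has_derivative f' x) (at x)) \<and> (\<forall>v. C_k k (\<lambda>x. f' x v)))"

definition smooth_fun :: "('a::euclidean_space \<Rightarrow> real) \<Rightarrow> bool" where
  "smooth_fun f \<longleftrightarrow> (\<forall>k. C_k k f)"

(* Near each boundary point, after a rotation taking the last coordinate direction to the unit
   vector e, the domain is the region above the graph of a smooth function of the remaining
   N - 1 coordinates.  A point x splits into its coordinate x \<bullet> e and its projection
   x - (x \<bullet> e) e to the hyperplane orthogonal to e; only the values of g on that hyperplane
   matter. *)
definition smooth_domain :: "'a::euclidean_space set \<Rightarrow> bool" where
  "smooth_domain \<Omega> \<longleftrightarrow> open \<Omega> \<and> connected \<Omega> \<and> \<Omega> \<noteq> {} \<and>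
     (\<forall>x0\<in>frontier \<Omega>. \<exists>r>0. \<exists>e g. norm e = 1 \<and> smooth_fun g \<and>
        \<Omega> \<inter> ball x0 r = {x \<in> ball x0 r. x \<bullet> e > g (x - (x \<bullet> e) *\<^sub>R e)})"

definition in_Lp :: "'a measure \<Rightarrow> real \<Rightarrow> ('a \<Rightarrow> real) \<Rightarrow> bool" where
  "in_Lp M p f \<longleftrightarrow> f \<in> borel_measurable M \<and> integrable M (\<lambda>x. \<bar>f x\<bar> powr p)"

definition L1_norm :: "'a measure \<Rightarrow> ('a \<Rightarrow> real) \<Rightarrow> real" where
  "L1_norm M f = (LINT x|M. \<bar>f x\<bar>)"

definition gagliardo_integral :: "real \<Rightarrow> real \<Rightarrow> ('a::euclidean_space \<Rightarrow> real) \<Rightarrow> ennreal" where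
  "gagliardo_integral s p u =
     (\<integral>\<^sup>+ (x, y). ennreal (\<bar>u x - u y\<bar> powr p / norm (x - y) powr (real DIM('a) + s * p))
        \<partial>(lebesgue \<Otimes>\<^sub>M lebesgue))"

(* Real-valued, hence meaningful only where gagliardo_integral is finite, as it is on W0. *)
definition gagliardo_seminorm :: "real \<Rightarrow> real \<Rightarrow> ('a::euclidean_space \<Rightarrow> real) \<Rightarrow> real" where
  "gagliardo_seminorm s p u = enn2real (gagliardo_integral s p u) powr (1 / p)"

definition W0 :: "'a::euclidean_space set \<Rightarrow> real \<Rightarrow> real \<Rightarrow> ('a \<Rightarrow> real) set" where
  "W0 \<Omega> s p = {u. in_Lp lebesgue p u \<and> gagliardo_integral s p u < \<infinity> \<and>
                   (AE x in lebesgue. x \<notin> \<Omega> \<longrightarrow> u x = 0)}"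

(* The minimum is attained for alpha close to 1, so there Inf is that minimum.  A non-integrable
   integrand has Bochner integral 0, so the constraint includes integrability. *)
definition lambda_min ::
    "'a::euclidean_space set \<Rightarrow> real \<Rightarrow> real \<Rightarrow> ('a \<Rightarrow> real) \<Rightarrow> real \<Rightarrow> real" where
  "lambda_min \<Omega> s p \<omega> \<alpha> =
     Inf {gagliardo_seminorm s p v powr p | v.
            v \<in> W0 \<Omega> s p \<and> (LINT x|lebesgue_on \<Omega>. \<bar>v x\<bar> powr (1 - \<alpha>) * \<omega> x) = 1}"

(* The library has ln 0 = 0 for real numbers, hence this version with log 0 = -\<infinity>. *)
definition log_ext :: "real \<Rightarrow> ereal" where
  "log_ext t = (if t = 0 then -\<infinity> else ereal (ln t))"

definition exp_ext :: "ereal \<Rightarrow> ereal" where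
  "exp_ext a = (case a of ereal t \<Rightarrow> ereal (exp t) | PInfty \<Rightarrow> \<infinity> | MInfty \<Rightarrow> 0)"

(* Integral of the positive part minus integral of the negative part; e2ennreal sends negative
   arguments to 0.  To be used only where at most one of the two is infinite. *)
definition integral_ext :: "'a measure \<Rightarrow> ('a \<Rightarrow> ereal) \<Rightarrow> ereal" where
  "integral_ext M f =
     enn2ereal (\<integral>\<^sup>+ x. e2ennreal (f x) \<partial>M) - enn2ereal (\<integral>\<^sup>+ x. e2ennreal (- f x) \<partial>M)"

end

theory Submission
  imports Defs
begin

text \<open>Put \<open>W = \<parallel>\<omega>\<parallel>\<^sub>1\<close>, \<open>q = 1 - \<alpha>\<close> and \<open>A = \<integral> |v|\<^sup>q \<omega>\<close>.  Rescaling v so that it becomes admissible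
  for \<open>\<lambda>\<^sub>\<alpha>\<close> gives \<open>\<lambda>\<^sub>\<alpha> A powr (p/q) \<le> [v]\<^sup>p\<close>.  Jensen's inequality for the probability measure \<open>\<omega>/W\<close>
  gives \<open>A/W \<ge> exp (q/W \<integral> (log |v|) \<omega>)\<close>.  Hence \<open>\<lambda>\<^sub>\<alpha> W powr (p/q) exp (p/W \<integral> (log |v|) \<omega>) \<le> [v]\<^sup>p\<close>,
  and it remains to let \<open>\<alpha>\<close> tend to 1.  For small q the integrability of \<open>|v|\<^sup>q \<omega>\<close> follows from
  \<open>v \<in> L\<^sup>p\<close> and \<open>\<omega> \<in> L\<^sup>r\<close> alone, without a Sobolev embedding.\<close>

section \<open>The extended logarithm and extended-valued integrals\<close>

lemma real_of_ereal_log_ext [simp]: "real_of_ereal (log_ext t) = ln t"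
  by (simp add: log_ext_def)

lemma log_ext_measurable [measurable]: "log_ext \<in> borel_measurable borel"
  unfolding log_ext_def by measurable

text \<open>With the positive part finite, the difference of the two parts is
  \<open>-\<infinity>\<close> or a difference of finite numbers, that is, a Bochner integral.
  Finiteness almost everywhere is returned separately because \<open>real_of_ereal\<close> sends
  infinite values to 0, so the real integrand no longer shows where they occur.\<close>

lemma integral_ext_cases:
  assumes [measurable]: "f \<in> borel_measurable M"
    and pos: "(\<integral>\<^sup>+ x. e2ennreal (f x) \<partial>M) < \<infinity>"
  obtains "integral_ext M f = -\<infinity>"
  | "integral_ext M f = ereal (LINT x|M. real_of_ereal (f x))"
    "integrable M (\<lambda>x. real_of_ereal (f x))" "AE x in M. \<bar>f x\<bar> \<noteq> \<infinity>"
proof (cases "(\<integral>\<^sup>+ x. e2ennreal (- f x) \<partial>M) = \<infinity>")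
  case True
  obtain P where "(\<integral>\<^sup>+ x. e2ennreal (f x) \<partial>M) = ennreal P" "0 \<le> P"
    using pos by (cases "\<integral>\<^sup>+ x. e2ennreal (f x) \<partial>M") auto
  then show ?thesis
    using True that(1) by (auto simp: integral_ext_def enn2ereal_ennreal)
next
  case False
  let ?g = "\<lambda>x. real_of_ereal (f x)"
  have 1: "AE x in M. e2ennreal (f x) \<noteq> \<infinity>"
    by (rule nn_integral_PInf_AE) (use pos in auto)
  have 2: "AE x in M. e2ennreal (- f x) \<noteq> \<infinity>"
    by (rule nn_integral_PInf_AE) (use False in auto)
  have fin: "AE x in M. \<bar>f x\<bar> \<noteq> \<infinity>"
    using 1 2 by eventually_elim (auto simp: e2ennreal_infty)
  have P: "(\<integral>\<^sup>+ x. e2ennreal (f x) \<partial>M) = (\<integral>\<^sup>+ x. ennreal (?g x) \<partial>M)"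
    by (rule nn_integral_cong_AE) (use fin in eventually_elim, auto simp: ennreal.abs_eq ereal_real)
  have N: "(\<integral>\<^sup>+ x. e2ennreal (- f x) \<partial>M) = (\<integral>\<^sup>+ x. ennreal (- ?g x) \<partial>M)"
  proof (rule nn_integral_cong_AE, use fin in eventually_elim)
    fix x assume "\<bar>f x\<bar> \<noteq> \<infinity>"
    then show "e2ennreal (- f x) = ennreal (- ?g x)" by (cases "f x") auto
  qed
  have int: "integrable M ?g"
    unfolding real_integrable_def using pos False P N by auto
  have "integral_ext M f = ereal (LINT x|M. ?g x)"
    using pos False unfolding integral_ext_def P N real_lebesgue_integral_def[OF int]
    by (cases "\<integral>\<^sup>+ x. ennreal (?g x) \<partial>M"; cases "\<integral>\<^sup>+ x. ennreal (- ?g x) \<partial>M") (auto simp: enn2ereal_ennreal)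
  then show ?thesis using that(2) int fin by auto
qed

section \<open>Integrability from the Lebesgue exponents on a finite measure space\<close>

lemma powr_le_one_plus_powr:
  fixes t :: real
  assumes "0 \<le> t" "0 < a" "a \<le> b"
  shows "t powr a \<le> 1 + t powr b"
proof (cases "t \<le> 1")
  case True
  then have "t powr a \<le> 1" using assms powr_le1[of a t] by simp
  then show ?thesis by (smt (verit) powr_ge_zero)
next
  case False
  then have "t powr a \<le> t powr b" using powr_mono[of a b t] assms by simp
  then show ?thesis by simp
qed

lemma in_Lp_imp_integrable:
  assumes "finite_measure M" "in_Lp M r f" "1 < r"
  shows "integrable M f"
proof -
  interpret finite_measure M by fact
  show ?thesis
  proof (rule Bochner_Integration.integrable_bound)
    show "integrable M (\<lambda>x. 1 + \<bar>f x\<bar> powr r)" using assms by (auto simp: in_Lp_def)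
    show "AE x in M. norm (f x) \<le> norm (1 + \<bar>f x\<bar> powr r)"
      using powr_le_one_plus_powr[of "\<bar>f _\<bar>" 1 r] assms by (auto intro!: AE_I2)
  qed (use assms in \<open>auto simp: in_Lp_def\<close>)
qed

text \<open>Young's inequality with the conjugate exponents \<open>r' = r / (r - 1)\<close> and
  \<open>r\<close> separates the two factors. Since \<open>q * r' \<le> p\<close>, the power of
  \<open>v\<close> is dominated by \<open>1 + \<bar>v x\<bar> powr p\<close>, and finiteness of the
  measure makes the constant integrable.\<close>

lemma integrable_powr_mult_in_Lp:
  assumes "finite_measure M" "in_Lp M p v" "in_Lp M r \<omega>" "1 < r" "0 < q" "q * (r / (r - 1)) \<le> p"
  shows "integrable M (\<lambda>x. \<bar>v x\<bar> powr q * \<omega> x)"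
proof -
  interpret finite_measure M by fact
  have [measurable]: "v \<in> borel_measurable M" "\<omega> \<in> borel_measurable M"
    using assms by (auto simp: in_Lp_def)
  define r' where "r' = r / (r - 1)"
  have r': "1 < r'" "1 / r' + 1 / r = 1" "q * r' \<le> p"
    using assms by (auto simp: r'_def field_simps)
  show ?thesis
  proof (rule Bochner_Integration.integrable_bound)
    show "integrable M (\<lambda>x. (1 + \<bar>v x\<bar> powr p) / r' + \<bar>\<omega> x\<bar> powr r / r)"
      using assms by (auto simp: in_Lp_def)
    show "AE x in M. norm (\<bar>v x\<bar> powr q * \<omega> x) \<le> norm ((1 + \<bar>v x\<bar> powr p) / r' + \<bar>\<omega> x\<bar> powr r / r)"
    proof (rule AE_I2)
      fix x
      have "\<bar>v x\<bar> powr q * \<bar>\<omega> x\<bar> \<le> (\<bar>v x\<bar> powr q) powr r' / r' + \<bar>\<omega> x\<bar> powr r / r"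
        using assms r' by (intro Youngs_inequality) auto
      also have "(\<bar>v x\<bar> powr q) powr r' \<le> 1 + \<bar>v x\<bar> powr p"
        unfolding powr_powr using assms r' by (intro powr_le_one_plus_powr) auto
      finally show "norm (\<bar>v x\<bar> powr q * \<omega> x) \<le> norm ((1 + \<bar>v x\<bar> powr p) / r' + \<bar>\<omega> x\<bar> powr r / r)"
        using r'(1) by (simp add: abs_mult divide_right_mono)
    qed
  qed measurable
qed

section \<open>Bounds on the logarithmic integral\<close>

lemma weighted_geometric_mean_le:
  fixes v \<omega> :: "'a \<Rightarrow> real"
  assumes \<omega>: "integrable M \<omega>" "AE x in M. 0 \<le> \<omega> x" and W: "W = (LINT x|M. \<omega> x)" "0 < W"
    and int_ln: "integrable M (\<lambda>x. ln \<bar>v x\<bar> * \<omega> x)"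
    and int_powr: "integrable M (\<lambda>x. \<bar>v x\<bar> powr q * \<omega> x)"
    and nz: "AE x in M. v x \<noteq> 0 \<or> \<omega> x = 0"
  shows "W * exp (q * (LINT x|M. ln \<bar>v x\<bar> * \<omega> x) / W) \<le> (LINT x|M. \<bar>v x\<bar> powr q * \<omega> x)"
proof -
  define I where "I = (LINT x|M. ln \<bar>v x\<bar> * \<omega> x)"
  define m where "m = I / W"
  \<comment> \<open>Jensen's inequality from the tangent line of exp at q m.\<close>
  have tangent: "exp (q * m) * ((1 - q * m) * \<omega> x + q * (ln \<bar>v x\<bar> * \<omega> x)) \<le> \<bar>v x\<bar> powr q * \<omega> x"
    if "0 \<le> \<omega> x" "v x \<noteq> 0 \<or> \<omega> x = 0" for x
  proof (cases "\<omega> x = 0")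
    case False
    then have "v x \<noteq> 0" using that by auto
    have "exp (q * m) * (1 + (q * ln \<bar>v x\<bar> - q * m)) \<le> exp (q * m) * exp (q * ln \<bar>v x\<bar> - q * m)"
      by (intro mult_left_mono exp_ge_add_one_self) auto
    also have "\<dots> = \<bar>v x\<bar> powr q"
      using \<open>v x \<noteq> 0\<close> by (simp add: powr_def flip: exp_add)
    finally show ?thesis
      using mult_right_mono[OF _ that(1)] by (fastforce simp: algebra_simps)
  qed auto
  \<comment> \<open>\<open>m\<close> is the weighted mean of \<open>ln \<bar>v x\<bar>\<close>, so
    \<open>I = m * W\<close> and the linear term of the tangent integrates to zero.\<close>
  have "W * exp (q * m) = exp (q * m) * ((1 - q * m) * W + q * I)"
    using W(2) by (simp add: m_def field_simps)
  also have "\<dots> = (LINT x|M. exp (q * m) * ((1 - q * m) * \<omega> x + q * (ln \<bar>v x\<bar> * \<omega> x)))"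
    using \<omega>(1) int_ln by (simp add: I_def W(1))
  also have "\<dots> \<le> (LINT x|M. \<bar>v x\<bar> powr q * \<omega> x)"
  proof (rule integral_mono_AE)
    show "AE x in M. exp (q * m) * ((1 - q * m) * \<omega> x + q * (ln \<bar>v x\<bar> * \<omega> x)) \<le> \<bar>v x\<bar> powr q * \<omega> x"
      using \<omega>(2) nz by eventually_elim (rule tangent)
  qed (use \<omega>(1) int_ln int_powr in auto)
  finally show ?thesis by (simp add: m_def I_def)
qed

text \<open>From \<open>ln t \<le> t powr q / q\<close>: only the positive part survives
  \<open>e2ennreal\<close>, so zeros of \<open>v\<close> contribute nothing. This places the
  logarithmic integral below \<open>\<infinity>\<close>.\<close>

lemma nn_integral_log_ext_finite:
  assumes \<omega>: "AE x in M. 0 \<le> \<omega> x" and "0 < q"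
    and int_powr: "integrable M (\<lambda>x. \<bar>v x\<bar> powr q * \<omega> x)"
  shows "(\<integral>\<^sup>+ x. e2ennreal (log_ext \<bar>v x\<bar> * ereal (\<omega> x)) \<partial>M) < \<infinity>"
proof -
  have le: "e2ennreal (log_ext \<bar>v x\<bar> * ereal (\<omega> x)) \<le> ennreal (\<bar>v x\<bar> powr q * \<omega> x / q)"
    if "0 \<le> \<omega> x" for x
  proof (cases "v x = 0")
    case True
    then show ?thesis using that by (cases "\<omega> x = 0") (auto simp: log_ext_def e2ennreal_neg)
  next
    case False
    have "q * ln \<bar>v x\<bar> \<le> \<bar>v x\<bar> powr q"
      using False exp_ge_add_one_self[of "q * ln \<bar>v x\<bar>"]
      by (simp add: powr_def del: exp_ge_add_one_self)
    then have "ln \<bar>v x\<bar> \<le> \<bar>v x\<bar> powr q / q"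
      using \<open>0 < q\<close> by (simp add: field_simps)
    then have "ln \<bar>v x\<bar> * \<omega> x \<le> \<bar>v x\<bar> powr q * \<omega> x / q"
      using mult_right_mono[OF _ that] by fastforce
    then show ?thesis using False by (auto simp: log_ext_def intro!: ennreal_leI)
  qed
  have "(\<integral>\<^sup>+ x. e2ennreal (log_ext \<bar>v x\<bar> * ereal (\<omega> x)) \<partial>M)
      \<le> (\<integral>\<^sup>+ x. ennreal (\<bar>v x\<bar> powr q * \<omega> x / q) \<partial>M)"
    by (rule nn_integral_mono_AE) (use \<omega> in eventually_elim, rule le)
  also have "\<dots> = ennreal (LINT x|M. \<bar>v x\<bar> powr q * \<omega> x / q)"
    by (rule nn_integral_eq_integral) (use int_powr \<omega> \<open>0 < q\<close> in auto)
  finally show ?thesis using le_less_trans by fastforce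
qed

section \<open>Homogeneity of the energy and the rescaled variational inequality\<close>

lemma gagliardo_integral_scale:
  fixes v :: "'a::euclidean_space \<Rightarrow> real"
  assumes [measurable]: "v \<in> borel_measurable lebesgue" and "0 < c"
  shows "gagliardo_integral s p (\<lambda>x. c * v x) = ennreal (c powr p) * gagliardo_integral s p v"
proof -
  \<comment> \<open>The kernel lives on the product of two completed measures; its Borel
    measurability rests on that of the identity on each factor.\<close>
  have [measurable]: "(\<lambda>x::'a. x) \<in> borel_measurable lebesgue"
    by (rule measurable_completion) simp
  have "ennreal (\<bar>c * v x - c * v y\<bar> powr p / d) = ennreal (c powr p) * ennreal (\<bar>v x - v y\<bar> powr p / d)"
    for x y d
  proof -
    have "\<bar>c * v x - c * v y\<bar> = c * \<bar>v x - v y\<bar>"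
      using \<open>0 < c\<close> by (simp add: abs_mult flip: right_diff_distrib)
    then show ?thesis
      using \<open>0 < c\<close> by (simp add: powr_mult ennreal_mult' flip: times_divide_eq_right)
  qed
  moreover have "(\<lambda>(x, y). ennreal (\<bar>v x - v y\<bar> powr p / norm (x - y) powr (real DIM('a) + s * p)))
      \<in> borel_measurable (lebesgue \<Otimes>\<^sub>M lebesgue)"
    by measurable
  ultimately show ?thesis
    by (simp add: gagliardo_integral_def case_prod_beta' nn_integral_cmult)
qed

lemma gagliardo_seminorm_powr:
  "0 < p \<Longrightarrow> gagliardo_seminorm s p v powr p = enn2real (gagliardo_integral s p v)"
  by (simp add: gagliardo_seminorm_def powr_powr)

lemma gagliardo_seminorm_scale:
  assumes "v \<in> borel_measurable lebesgue" "0 < c" "0 < p"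
  shows "gagliardo_seminorm s p (\<lambda>x. c * v x) powr p = c powr p * gagliardo_seminorm s p v powr p"
  using assms by (simp add: gagliardo_seminorm_powr gagliardo_integral_scale enn2real_mult)

lemma W0_scale:
  assumes v: "v \<in> W0 \<Omega> s p" and "0 < c"
  shows "(\<lambda>x. c * v x) \<in> W0 \<Omega> s p"
proof -
  have [measurable]: "v \<in> borel_measurable lebesgue" using v by (auto simp: W0_def in_Lp_def)
  show ?thesis
    using v \<open>0 < c\<close> unfolding W0_def in_Lp_def
    by (auto simp: gagliardo_integral_scale abs_mult powr_mult ennreal_mult_less_top)
qed

lemma lambda_min_le:
  assumes v: "v \<in> W0 \<Omega> s p" and "\<alpha> < 1" "0 < p"
    and A: "A = (LINT x|lebesgue_on \<Omega>. \<bar>v x\<bar> powr (1 - \<alpha>) * \<omega> x)" "0 < A"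
  shows "lambda_min \<Omega> s p \<omega> \<alpha> * A powr (p / (1 - \<alpha>)) \<le> gagliardo_seminorm s p v powr p"
proof -
  \<comment> \<open>Chosen so that \<open>c powr (1 - \<alpha>) * A = 1\<close>, which makes
    \<open>c * v\<close> admissible.\<close>
  define c where "c = A powr (- 1 / (1 - \<alpha>))"
  have c: "0 < c" "c powr (1 - \<alpha>) = 1 / A" "c powr p = inverse (A powr (p / (1 - \<alpha>)))"
  proof -
    show "c powr (1 - \<alpha>) = 1 / A"
      unfolding c_def powr_powr using A(2) \<open>\<alpha> < 1\<close> by (simp add: powr_minus_divide)
    show "c powr p = inverse (A powr (p / (1 - \<alpha>)))"
      unfolding c_def powr_powr powr_minus[symmetric] by (simp add: field_simps)
  qed (use A(2) in \<open>simp add: c_def\<close>)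
  have "(LINT x|lebesgue_on \<Omega>. \<bar>c * v x\<bar> powr (1 - \<alpha>) * \<omega> x)
      = (LINT x|lebesgue_on \<Omega>. c powr (1 - \<alpha>) * (\<bar>v x\<bar> powr (1 - \<alpha>) * \<omega> x))"
    using c(1) by (simp add: abs_mult powr_mult mult.assoc)
  also have "\<dots> = 1" using A c(2) by simp
  finally have "lambda_min \<Omega> s p \<omega> \<alpha> \<le> gagliardo_seminorm s p (\<lambda>x. c * v x) powr p"
    unfolding lambda_min_def
    \<comment> \<open>A real \<open>Inf\<close> lies below the members of a set bounded below; here
      0 is a lower bound, the energies being powers.\<close>
    by (intro cInf_lower bdd_belowI[of _ 0]) (use W0_scale[OF v c(1)] in auto)
  also have "\<dots> = inverse (A powr (p / (1 - \<alpha>))) * gagliardo_seminorm s p v powr p"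
    using v c \<open>0 < p\<close> by (subst gagliardo_seminorm_scale) (auto simp: W0_def in_Lp_def)
  finally show ?thesis using A(2) by (simp add: field_simps)
qed

section \<open>The estimate for fixed exponent and the passage to the limit\<close>

theorem theorem4p0p4:
  fixes \<Omega> :: "(real ^ 'n) set" and s p r :: real
    and \<omega> :: "real ^ 'n \<Rightarrow> real" and \<mu> :: ereal
  assumes "CARD('n) \<ge> 2"
    and "smooth_domain \<Omega>" and "bounded \<Omega>"
    and "0 < s" and "s < 1" and "1 < p"
    and "1 < r" and "in_Lp (lebesgue_on \<Omega>) r \<omega>"
    and "AE x in lebesgue_on \<Omega>. 0 \<le> \<omega> x"
    and "\<not> (AE x in lebesgue_on \<Omega>. \<omega> x = 0)"
    and "((\<lambda>\<alpha>. ereal (lambda_min \<Omega> s p \<omega> \<alpha> *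
            L1_norm (lebesgue_on \<Omega>) \<omega> powr (p / (1 - \<alpha>)))) \<longlongrightarrow> \<mu>) (at_left 1)"
    and "\<mu> < \<infinity>"
  shows "\<forall>v \<in> W0 \<Omega> s p.
           \<mu> * exp_ext (ereal (p / L1_norm (lebesgue_on \<Omega>) \<omega>) *
                 integral_ext (lebesgue_on \<Omega>) (\<lambda>x. log_ext \<bar>v x\<bar> * ereal (\<omega> x)))
           \<le> ereal (gagliardo_seminorm s p v powr p)"
proof
  fix v assume v: "v \<in> W0 \<Omega> s p"
  note \<omega>_Lp = assms(8) and \<omega>_nonneg = assms(9)
  let ?M = "lebesgue_on \<Omega>"
  let ?f = "\<lambda>x. log_ext \<bar>v x\<bar> * ereal (\<omega> x)"
  let ?V = "gagliardo_seminorm s p v powr p"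
  define W where "W = L1_norm ?M \<omega>"
  have "open \<Omega>" using assms by (auto simp: smooth_domain_def)
  then have \<Omega>: "\<Omega> \<in> lmeasurable"
    using \<open>bounded \<Omega>\<close> lmeasurable_open by blast
  then have fin: "finite_measure ?M"
    by (intro finite_measure_lebesgue_on)
  have \<omega>_int: "integrable ?M \<omega>"
    using in_Lp_imp_integrable[OF fin \<omega>_Lp] \<open>1 < r\<close> .
  have [measurable]: "\<omega> \<in> borel_measurable ?M" using \<omega>_Lp by (auto simp: in_Lp_def)
  have W: "W = (LINT x|?M. \<omega> x)"
    unfolding W_def L1_norm_def by (rule integral_cong_AE) (use \<omega>_nonneg in auto)
  have "W \<noteq> 0"
    using integral_nonneg_eq_0_iff_AE[OF \<omega>_int \<omega>_nonneg] assms(10) W by auto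
  moreover have "0 \<le> W"
    unfolding W_def L1_norm_def by simp
  ultimately have "0 < W" by simp
  have v_Lp: "in_Lp ?M p v"
    using v integrable_mult_indicator[of \<Omega> lebesgue "\<lambda>x. \<bar>v x\<bar> powr p"] fmeasurableD[OF \<Omega>]
    by (auto simp: W0_def in_Lp_def integrable_restrict_space intro!: measurable_restrict_space1)
  then have [measurable]: "v \<in> borel_measurable ?M" by (auto simp: in_Lp_def)
  \<comment> \<open>The largest \<open>q\<close> with \<open>q * (r / (r - 1)) \<le> p\<close>, the
    range of the Young estimate.\<close>
  define q0 where "q0 = p * (r - 1) / r"
  have "0 < q0" using assms by (simp add: q0_def)
  have powr_int: "integrable ?M (\<lambda>x. \<bar>v x\<bar> powr q * \<omega> x)" if "0 < q" "q \<le> q0" for q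
    using integrable_powr_mult_in_Lp[OF fin v_Lp \<omega>_Lp \<open>1 < r\<close> \<open>0 < q\<close>] that(2) \<open>1 < r\<close>
    by (simp add: q0_def field_simps)
  have "?f \<in> borel_measurable ?M" by measurable
  moreover have "(\<integral>\<^sup>+ x. e2ennreal (?f x) \<partial>?M) < \<infinity>"
    using nn_integral_log_ext_finite[OF \<omega>_nonneg \<open>0 < q0\<close> powr_int] \<open>0 < q0\<close> by simp
  ultimately consider (minf) "integral_ext ?M ?f = -\<infinity>"
    | (fin) "integral_ext ?M ?f = ereal (LINT x|?M. ln \<bar>v x\<bar> * \<omega> x)"
      "integrable ?M (\<lambda>x. ln \<bar>v x\<bar> * \<omega> x)" "AE x in ?M. \<bar>?f x\<bar> \<noteq> \<infinity>"
    by (rule integral_ext_cases) auto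
  then have "\<mu> * exp_ext (ereal (p / W) * integral_ext ?M ?f) \<le> ereal ?V"
  proof cases
    case minf
    \<comment> \<open>The exponential is 0 here, so the left side is 0 and the right side is a
      power.\<close>
    then show ?thesis using \<open>0 < W\<close> assms(6) by (simp add: exp_ext_def)
  next
    case fin
    define I where "I = (LINT x|?M. ln \<bar>v x\<bar> * \<omega> x)"
    define E where "E = exp (p / W * I)"
    \<comment> \<open>At a point with \<open>v x = 0\<close> and
      \<open>\<omega> x \<noteq> 0\<close> the extended integrand is infinite, so such points form a
      null set. This rules out the effect of \<open>ln 0 = 0\<close>.\<close>
    have nz: "AE x in ?M. v x \<noteq> 0 \<or> \<omega> x = 0"
      using fin(3) by eventually_elim (auto simp: log_ext_def split: if_splits)
    have bound: "lambda_min \<Omega> s p \<omega> \<alpha> * W powr (p / (1 - \<alpha>)) \<le> ?V / E"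
      if "\<alpha> < 1" "1 - \<alpha> \<le> q0" for \<alpha>
    proof -
      define q where "q = 1 - \<alpha>"
      define A where "A = (LINT x|?M. \<bar>v x\<bar> powr q * \<omega> x)"
      have q: "0 < q" "q \<le> q0" using that by (auto simp: q_def)
      have WA: "W * exp (q * I / W) \<le> A"
        unfolding A_def I_def
        by (rule weighted_geometric_mean_le[OF \<omega>_int \<omega>_nonneg W \<open>0 < W\<close> fin(2) powr_int[OF q] nz])
      then have "0 < A" using \<open>0 < W\<close> by (smt (verit) exp_gt_zero mult_pos_pos)
      \<comment> \<open>Raising to the power \<open>p / q\<close> cancels \<open>q\<close> in the
        exponential, so \<open>E\<close> is the same for all \<open>\<alpha>\<close>.\<close>
      have "W powr (p / q) * E = (W * exp (q * I / W)) powr (p / q)"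
        using \<open>0 < W\<close> q by (simp add: E_def powr_mult exp_powr_real mult.commute)
      also have "\<dots> \<le> A powr (p / q)"
        using WA \<open>0 < W\<close> q assms by (intro powr_mono2) auto
      finally have WE: "W powr (p / q) * E \<le> A powr (p / q)" .
      have "lambda_min \<Omega> s p \<omega> \<alpha> * (W powr (p / q) * E) \<le> ?V"
      \<comment> \<open>Multiplying \<open>WE\<close> by the infimum preserves the order only if the
        infimum is nonnegative; a negative one makes the left side nonpositive, below the
        energy.\<close>
      proof (cases "0 \<le> lambda_min \<Omega> s p \<omega> \<alpha>")
        case True
        then have "lambda_min \<Omega> s p \<omega> \<alpha> * (W powr (p / q) * E) \<le> lambda_min \<Omega> s p \<omega> \<alpha> * A powr (p / q)"
          using WE by (rule mult_left_mono[rotated])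
        also have "\<dots> \<le> ?V"
          using lambda_min_le[OF v \<open>\<alpha> < 1\<close> _ _ \<open>0 < A\<close>] assms by (simp add: A_def q_def)
        finally show ?thesis .
      next
        case False
        then have "lambda_min \<Omega> s p \<omega> \<alpha> * (W powr (p / q) * E) \<le> 0"
          by (simp add: mult_nonpos_nonneg E_def)
        then show ?thesis by (smt (verit) powr_ge_zero)
      qed
      then show ?thesis by (simp add: E_def q_def field_simps)
    qed
    have "\<forall>\<^sub>F \<alpha> in at_left 1. \<alpha> \<in> {1 - q0<..<1}"
      using \<open>0 < q0\<close> by (intro eventually_at_left_real) simp
    then have "\<forall>\<^sub>F \<alpha> in at_left 1. ereal (lambda_min \<Omega> s p \<omega> \<alpha> * W powr (p / (1 - \<alpha>))) \<le> ereal (?V / E)"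
    proof eventually_elim
      case (elim \<alpha>)
      then show ?case using bound[of \<alpha>] by simp
    qed
    \<comment> \<open>The bound is independent of \<open>\<alpha>\<close>, hence it survives the
      left limit.\<close>
    then have "\<mu> \<le> ereal (?V / E)"
      using tendsto_upperbound[OF assms(11)] unfolding W_def by simp
    then have "\<mu> * ereal E \<le> ereal (?V / E) * ereal E"
      by (intro ereal_mult_right_mono) (auto simp: E_def)
    then show ?thesis
      by (simp add: fin(1) exp_ext_def E_def I_def)
  qed
  then show "\<mu> * exp_ext (ereal (p / L1_norm ?M \<omega>) * integral_ext ?M ?f) \<le> ereal ?V"
    by (simp add: W_def)
qed

end
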